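(* Let $\mathcal I$ be an ideal on $\mathbb N$ with the Baire property and let $(x_n)$ be a divergent sequence in a metric space $(X,d)$. Then the sets $$E(\mathcal I,(x_n)):=\{ s\in S\colon (x_{s(n)})\text{ is }\mathcal I\text{-convergent}\}\quad\text{and}\quad R(\mathcal I,(x_n)):=\{ p\in P\colon (x_{p(n)})\text{ is }\mathcal I\text{-convergent}\}$$ are meager in $S$ and $P$, respectively.
   Context: $\mathbb N=\{1,2,\dots\}$. $S:=\{ s\in\mathbb N^{\mathbb N}\colon \forall n\in\mathbb N\; s(n)<s(n+1)\}$ and $P:=\{ p\in\mathbb N^{\mathbb N}\colon p\text{ is a bijection}\}$, both with the subspace topology inherited from $\mathbb N^{\mathbb N}$ (product of discrete spaces); they are $G_\delta$ subsets of $\mathbb N^{\mathbb N}$, hence Polish spaces. All ideals are assumed admissible: an ideal on $\mathbb N$ is an ideal $\mathcal I\subset\mathcal P(\mathbb N)$ (a family closed under subsets and finite unions) such that $\mathbb N\notin\mathcal I$ and every finite subset of $\mathbb N$ belongs to $\mathcal I$. Via characteristic functions, $\mathcal I$ is regarded as a subset of the Polish space $\{0,1\}^{\mathbb N}$; "$\mathcal I$ has the Baire property" refers to this space. (Sets with the Baire property in a metric space form the smallest $\sigma$-algebra containing the open sets and the meager sets.) A sequence $(x_n)$ in a metric space $(X,d)$ is $\mathcal I$-convergent to $x\in X$ if for every $\varepsilon>0$ we have $\{n\in\mathbb N\colon d(x_n,x)\ge\varepsilon\}\in\mathcal I$; it is $\mathcal I$-convergent if it is $\mathcal I$-convergent to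 some $x\in X$. "Divergent" means not convergent (in the usual sense) to any point of $X$. *)

theory Defs
  imports "HOL-Analysis.Analysis"
begin

section \<open>Category notions in a topological space\<close>

definition nowhere_dense_in :: "'a topology \<Rightarrow> 'a set \<Rightarrow> bool" where
  "nowhere_dense_in T A \<longleftrightarrow> A \<subseteq> topspace T \<and> T interior_of (T closure_of A) = {}"

definition meager_in :: "'a topology \<Rightarrow> 'a set \<Rightarrow> bool" where
  "meager_in T A \<longleftrightarrow>
     (\<exists>\<F>. countable \<F> \<and> (\<forall>F\<in>\<F>. nowhere_dense_in T F) \<and> A = \<Union>\<F>)"

definition baire_property_in :: "'a topology \<Rightarrow> 'a set \<Rightarrow> bool" where
  "baire_property_in T A \<longleftrightarrow>
     A \<in> sigma_sets (topspace T) ({U. openin T U} \<union> {M. meager_in T M})"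

section \<open>Spaces of sequences indexed by the positive integers\<close>

text \<open>Indices start at 1. A point of a product over \<open>Npos\<close> is an
  extensional function: it takes the value \<open>undefined\<close> at the index 0.\<close>

abbreviation Npos :: "nat set" where
  "Npos \<equiv> {1..}"

definition baire_space :: "(nat \<Rightarrow> nat) topology" where
  "baire_space = product_topology (\<lambda>_. discrete_topology Npos) Npos"

definition cantor_space :: "(nat \<Rightarrow> nat) topology" where
  "cantor_space = product_topology (\<lambda>_. discrete_topology {0, 1}) Npos"

definition incr_seqs :: "(nat \<Rightarrow> nat) set" where
  "incr_seqs = {s \<in> topspace baire_space. \<forall>n\<in>Npos. s n < s (n + 1)}"

definition permutations_Npos :: "(nat \<Rightarrow> nat) set" where
  "permutations_Npos = {p \<in> topspace baire_space. bij_betw p Npos Npos}"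

section \<open>Ideals and ideal convergence\<close>

definition admissible_ideal :: "nat set set \<Rightarrow> bool" where
  "admissible_ideal \<I> \<longleftrightarrow>
     \<I> \<subseteq> Pow Npos \<and>
     (\<forall>A\<in>\<I>. \<forall>B. B \<subseteq> A \<longrightarrow> B \<in> \<I>) \<and>
     (\<forall>A\<in>\<I>. \<forall>B\<in>\<I>. A \<union> B \<in> \<I>) \<and>
     Npos \<notin> \<I> \<and>
     (\<forall>A. A \<subseteq> Npos \<longrightarrow> finite A \<longrightarrow> A \<in> \<I>)"

definition char_fun :: "nat set \<Rightarrow> nat \<Rightarrow> nat" where
  "char_fun A = restrict (indicator A) Npos"

definition ideal_has_baire_property :: "nat set set \<Rightarrow> bool" where
  "ideal_has_baire_property \<I> \<longleftrightarrow> baire_property_in cantor_space (char_fun ` \<I>)"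

definition ideal_converges_to ::
    "nat set set \<Rightarrow> 'a set \<Rightarrow> ('a \<Rightarrow> 'a \<Rightarrow> real) \<Rightarrow> (nat \<Rightarrow> 'a) \<Rightarrow> 'a \<Rightarrow> bool" where
  "ideal_converges_to \<I> X d x l \<longleftrightarrow>
     l \<in> X \<and> (\<forall>\<epsilon>>0. {n \<in> Npos. d (x n) l \<ge> \<epsilon>} \<in> \<I>)"

definition ideal_convergent ::
    "nat set set \<Rightarrow> 'a set \<Rightarrow> ('a \<Rightarrow> 'a \<Rightarrow> real) \<Rightarrow> (nat \<Rightarrow> 'a) \<Rightarrow> bool" where
  "ideal_convergent \<I> X d x \<longleftrightarrow> (\<exists>l\<in>X. ideal_converges_to \<I> X d x l)"

text \<open>The value of \<open>x\<close> at the index 0 is irrelevant for convergence along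
  \<open>sequentially\<close>.\<close>

definition divergent_in ::
    "'a set \<Rightarrow> ('a \<Rightarrow> 'a \<Rightarrow> real) \<Rightarrow> (nat \<Rightarrow> 'a) \<Rightarrow> bool" where
  "divergent_in X d x \<longleftrightarrow>
     \<not> (\<exists>l. limitin (Metric_space.mtopology X d) x l sequentially)"

definition E_set ::
    "nat set set \<Rightarrow> 'a set \<Rightarrow> ('a \<Rightarrow> 'a \<Rightarrow> real) \<Rightarrow> (nat \<Rightarrow> 'a) \<Rightarrow> (nat \<Rightarrow> nat) set" where
  "E_set \<I> X d x = {s \<in> incr_seqs. ideal_convergent \<I> X d (\<lambda>n. x (s n))}"

definition R_set ::
    "nat set set \<Rightarrow> 'a set \<Rightarrow> ('a \<Rightarrow> 'a \<Rightarrow> real) \<Rightarrow> (nat \<Rightarrow> 'a) \<Rightarrow> (nat \<Rightarrow> nat) set" where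
  "R_set \<I> X d x = {p \<in> permutations_Npos. ideal_convergent \<I> X d (\<lambda>n. x (p n))}"

end

theory Submission
  imports Defs
begin

text \<open>A zero-one law shows that an ideal \<open>\<I>\<close> with the Baire property is meager: otherwise it is
  comeager in some cylinder, and flipping all coordinates beyond that cylinder produces two members
  of \<open>\<I>\<close> whose union is cofinite. If \<open>B\<close> is infinite and co-infinite, the map sending \<open>s\<close> to the
  preimage \<open>s\<^sup>-\<^sup>1(B)\<close> sends nonempty open sets of \<open>S\<close> or \<open>P\<close> to somewhere dense sets, because finite
  initial segments can be extended so as to realise any prescribed 0-1 pattern. Hence it pulls \<open>\<I>\<close>
  back to a meager set. Finally, since \<open>x\<close> does not converge to a candidate limit \<open>l\<close>, there are a
  term \<open>x j\<close> close to \<open>l\<close> and a radius \<open>q = 1/(k+1)\<close> such that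
  \<open>B = {m. d (x m) (x j) \<ge> q}\<close> is infinite and the preimage of \<open>B\<close> lies in \<open>\<I>\<close>; only
  countably many such \<open>B\<close> occur.\<close>

section \<open>Meager sets and the Baire property\<close>

lemma nowhere_dense_in_subset:
  assumes "nowhere_dense_in T A" "B \<subseteq> A"
  shows "nowhere_dense_in T B"
  using assms interior_of_mono[OF closure_of_mono[OF assms(2)], of T T]
  unfolding nowhere_dense_in_def by auto

lemma meager_in_subset:
  assumes "meager_in T A" "B \<subseteq> A"
  shows "meager_in T B"
proof -
  obtain \<F> where \<F>: "countable \<F>" "\<forall>F\<in>\<F>. nowhere_dense_in T F" "A = \<Union>\<F>"
    using assms(1) unfolding meager_in_def by auto
  show ?thesis
    unfolding meager_in_def
  proof (intro exI conjI)
    show "countable ((\<lambda>F. F \<inter> B) ` \<F>)" using \<F>(1) by simp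
    show "\<forall>F\<in>(\<lambda>F. F \<inter> B) ` \<F>. nowhere_dense_in T F"
      using \<F>(2) nowhere_dense_in_subset by blast
    show "B = \<Union>((\<lambda>F. F \<inter> B) ` \<F>)" using \<F>(3) assms(2) by auto
  qed
qed

lemma meager_in_UN:
  assumes "countable K" "\<And>k. k \<in> K \<Longrightarrow> meager_in T (A k)"
  shows "meager_in T (\<Union>k\<in>K. A k)"
proof -
  have "\<forall>k\<in>K. \<exists>\<F>. countable \<F> \<and> (\<forall>F\<in>\<F>. nowhere_dense_in T F) \<and> A k = \<Union>\<F>"
    using assms(2) unfolding meager_in_def by blast
  then obtain \<F> where \<F>: "\<And>k. k \<in> K \<Longrightarrow>
      countable (\<F> k) \<and> (\<forall>F\<in>\<F> k. nowhere_dense_in T F) \<and> A k = \<Union>(\<F> k)"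
    by metis
  show ?thesis
    unfolding meager_in_def
    by (rule exI[of _ "\<Union>k\<in>K. \<F> k"]) (use \<F> assms(1) in auto)
qed

lemma meager_in_Un:
  assumes "meager_in T A" "meager_in T B"
  shows "meager_in T (A \<union> B)"
proof -
  have "meager_in T (\<Union>C\<in>{A, B}. C)"
    by (rule meager_in_UN) (use assms in auto)
  then show ?thesis by simp
qed

lemma meager_in_empty: "meager_in T {}"
  unfolding meager_in_def by (rule exI[of _ "{}"]) auto

lemma nowhere_dense_imp_meager_in: "nowhere_dense_in T A \<Longrightarrow> meager_in T A"
  unfolding meager_in_def by (rule exI[of _ "{A}"]) auto

text \<open>The frontier of an open \<open>U\<close> lies in the closure of \<open>U\<close> but
  misses \<open>U\<close>; a nonempty open subset of it would have to meet \<open>U\<close>.\<close>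

lemma nowhere_dense_in_frontier_openin:
  assumes "openin T U"
  shows "nowhere_dense_in T (T frontier_of U)"
proof -
  have "T interior_of (T frontier_of U) = {}"
  proof (rule ccontr)
    assume "T interior_of (T frontier_of U) \<noteq> {}"
    then obtain z where z: "z \<in> T interior_of (T frontier_of U)" by auto
    then have "z \<in> T closure_of U"
      using interior_of_subset[of T "T frontier_of U"] by (auto simp: frontier_of_def)
    then obtain w where "w \<in> U" "w \<in> T interior_of (T frontier_of U)"
      using z openin_interior_of by (metis in_closure_of)
    then show False
      using interior_of_subset[of T "T frontier_of U"] frontier_of_openin[OF assms] by blast
  qed
  then show ?thesis
    by (simp add: nowhere_dense_in_def frontier_of_subset_topspace closure_of_closedin
        closedin_frontier_of)
qed

text \<open>Sets that agree with an open set up to a meager set are closed under complements and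
  countable unions, so induction over the generated sigma-algebra applies.\<close>

lemma baire_property_in_imp_open_mod_meager:
  assumes "baire_property_in T A"
  shows "\<exists>U. openin T U \<and> meager_in T (A - U \<union> (U - A))"
  using assms unfolding baire_property_in_def
proof (induction A rule: sigma_sets.induct)
  case (Basic A)
  then show ?case
  proof
    assume "A \<in> {U. openin T U}"
    then show ?thesis by (auto intro!: exI[of _ A] simp: meager_in_empty)
  next
    assume "A \<in> {M. meager_in T M}"
    then show ?thesis by (auto intro!: exI[of _ "{}"])
  qed
next
  case Empty
  show ?case by (rule exI[of _ "{}"]) (simp add: meager_in_empty)
next
  case (Compl A)
  then obtain U where U: "openin T U" "meager_in T (A - U \<union> (U - A))" by auto
  \<comment> \<open>The complement of \<open>U\<close> need not be open, so the exterior is taken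
    instead; the discrepancy is the frontier, which is nowhere dense.\<close>
  let ?V = "topspace T - T closure_of U"
  have "meager_in T ((A - U \<union> (U - A)) \<union> T frontier_of U)"
    by (intro meager_in_Un U(2) nowhere_dense_imp_meager_in nowhere_dense_in_frontier_openin U(1))
  moreover have "U \<subseteq> T closure_of U"
    by (simp add: U(1) closure_of_subset openin_subset)
  then have "(topspace T - A) - ?V \<union> (?V - (topspace T - A))
      \<subseteq> (A - U \<union> (U - A)) \<union> T frontier_of U"
    using frontier_of_openin[OF U(1)] by auto
  ultimately have "meager_in T ((topspace T - A) - ?V \<union> (?V - (topspace T - A)))"
    by (rule meager_in_subset)
  moreover have "openin T ?V" by (simp add: openin_diff)
  ultimately show ?case by blast
next
  case (Union A)
  then obtain U where U: "\<And>i. openin T (U i)" "\<And>i. meager_in T (A i - U i \<union> (U i - A i))"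
    by metis
  have "meager_in T (\<Union>i. A i - U i \<union> (U i - A i))"
    by (rule meager_in_UN) (use U in auto)
  then have "meager_in T ((\<Union>i. A i) - (\<Union>i. U i) \<union> ((\<Union>i. U i) - (\<Union>i. A i)))"
    by (rule meager_in_subset) blast
  moreover have "openin T (\<Union>i. U i)" using U(1) by blast
  ultimately show ?case by blast
qed

text \<open>If the preimage were dense in a nonempty open set, continuity would send that set into
  the closure of \<open>F\<close>, and \<open>big\<close> would give this closure an interior
  point.\<close>

lemma nowhere_dense_in_preimage:
  assumes f: "continuous_map X Y f"
    and big: "\<And>U. openin X U \<Longrightarrow> U \<noteq> {} \<Longrightarrow> Y interior_of (Y closure_of (f ` U)) \<noteq> {}"
    and F: "nowhere_dense_in Y F"
  shows "nowhere_dense_in X {x \<in> topspace X. f x \<in> F}"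
proof -
  let ?U = "X interior_of (X closure_of {x \<in> topspace X. f x \<in> F})"
  have "?U = {}"
  proof (rule ccontr)
    assume "?U \<noteq> {}"
    then have "Y interior_of (Y closure_of (f ` ?U)) \<noteq> {}" by (simp add: big)
    moreover have "f ` ?U \<subseteq> Y closure_of F"
      using continuous_map_closure_preimage_subset[OF f, of F] interior_of_subset by fastforce
    then have "Y interior_of (Y closure_of (f ` ?U)) \<subseteq> Y interior_of (Y closure_of F)"
      by (metis closure_of_closure_of closure_of_mono interior_of_mono)
    ultimately show False
      using F by (auto simp: nowhere_dense_in_def)
  qed
  then show ?thesis by (auto simp: nowhere_dense_in_def)
qed

lemma meager_in_preimage:
  assumes f: "continuous_map X Y f"
    and big: "\<And>U. openin X U \<Longrightarrow> U \<noteq> {} \<Longrightarrow> Y interior_of (Y closure_of (f ` U)) \<noteq> {}"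
    and M: "meager_in Y M"
  shows "meager_in X {x \<in> topspace X. f x \<in> M}"
proof -
  obtain \<F> where \<F>: "countable \<F>" "\<forall>F\<in>\<F>. nowhere_dense_in Y F" "M = \<Union>\<F>"
    using M unfolding meager_in_def by auto
  have "meager_in X (\<Union>F\<in>\<F>. {x \<in> topspace X. f x \<in> F})"
    by (intro meager_in_UN \<F>(1) nowhere_dense_imp_meager_in nowhere_dense_in_preimage[OF f big])
      (use \<F>(2) in auto)
  moreover have "(\<Union>F\<in>\<F>. {x \<in> topspace X. f x \<in> F}) = {x \<in> topspace X. f x \<in> M}"
    using \<F>(3) by auto
  ultimately show ?thesis by simp
qed

text \<open>Replacing the nowhere dense pieces by their closures makes the Baire category theorem
  applicable: their union has empty interior.\<close>

lemma compact_Hausdorff_open_not_meager_in: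
  assumes "compact_space T" "Hausdorff_space T" "openin T U" "U \<noteq> {}"
  shows "\<not> meager_in T U"
proof
  assume "meager_in T U"
  then obtain \<F> where \<F>: "countable \<F>" "\<forall>F\<in>\<F>. nowhere_dense_in T F" "U = \<Union>\<F>"
    unfolding meager_in_def by auto
  have "T interior_of \<Union>((\<lambda>F. T closure_of F) ` \<F>) = {}"
  proof (rule Baire_category_alt)
    show "completely_metrizable_space T \<or> locally_compact_space T \<and> regular_space T"
      using assms by (simp add: compact_Hausdorff_imp_regular_space compact_imp_locally_compact_space)
  qed (use \<F> in \<open>auto simp: nowhere_dense_in_def\<close>)
  moreover have "U \<subseteq> \<Union>((\<lambda>F. T closure_of F) ` \<F>)"
    using \<F> by (auto simp: nowhere_dense_in_def) (meson closure_of_subset subsetD)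
  ultimately show False
    using interior_of_maximal[OF _ assms(3)] assms(4) by blast
qed

section \<open>Cylinders in sequence spaces\<close>

text \<open>A basic open set of the product restricts finitely many coordinates, and these are
  bounded by some \<open>n\<close>; so agreement on an initial segment is enough to describe
  neighbourhoods.\<close>

lemma openin_sequence_space_iff:
  "openin (product_topology (\<lambda>_. discrete_topology D) Npos) U \<longleftrightarrow>
     U \<subseteq> Npos \<rightarrow>\<^sub>E D \<and>
     (\<forall>s\<in>U. \<exists>n. \<forall>t\<in>Npos \<rightarrow>\<^sub>E D. (\<forall>i\<in>{1..n}. t i = s i) \<longrightarrow> t \<in> U)"
  (is "?L \<longleftrightarrow> ?R")
proof
  assume L: ?L
  show ?R
  proof (intro conjI ballI)
    show "U \<subseteq> Npos \<rightarrow>\<^sub>E D" using openin_subset[OF L] by simp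
    fix s assume "s \<in> U"
    then obtain W where W: "finite {i \<in> Npos. W i \<noteq> D}" "s \<in> Pi\<^sub>E Npos W" "Pi\<^sub>E Npos W \<subseteq> U"
      using L unfolding openin_product_topology_alt by fastforce
    obtain n where n: "\<And>i. i \<in> Npos \<Longrightarrow> W i \<noteq> D \<Longrightarrow> i \<le> n"
      using W(1) unfolding finite_nat_set_iff_bounded_le by auto
    show "\<exists>n. \<forall>t\<in>Npos \<rightarrow>\<^sub>E D. (\<forall>i\<in>{1..n}. t i = s i) \<longrightarrow> t \<in> U"
    proof (intro exI[of _ n] ballI impI)
      fix t assume t: "t \<in> Npos \<rightarrow>\<^sub>E D" "\<forall>i\<in>{1..n}. t i = s i"
      have "t i \<in> W i" if i: "i \<in> Npos" for i
      proof (cases "W i = D")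
        case True then show ?thesis using t(1) i by auto
      next
        case False
        then have "t i = s i" using n[OF i] t(2) i by auto
        then show ?thesis using W(2) i by auto
      qed
      then have "t \<in> Pi\<^sub>E Npos W" using t(1) by (auto simp: PiE_iff)
      then show "t \<in> U" using W(3) by blast
    qed
  qed
next
  assume R: ?R
  show ?L
    unfolding openin_product_topology_alt
  proof
    fix s assume s: "s \<in> U"
    obtain n where n: "\<And>t. t \<in> Npos \<rightarrow>\<^sub>E D \<Longrightarrow> \<forall>i\<in>{1..n}. t i = s i \<Longrightarrow> t \<in> U"
      using R s by blast
    have sD: "s \<in> Npos \<rightarrow>\<^sub>E D" using R s by blast
    define W where "W = (\<lambda>i. if i \<le> n then {s i} else D)"
    have "finite {i \<in> Npos. W i \<noteq> topspace (discrete_topology D)}"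
      by (rule finite_subset[of _ "{..n}"]) (auto simp: W_def)
    moreover have "\<forall>i\<in>Npos. openin (discrete_topology D) (W i)"
      using sD by (auto simp: W_def)
    moreover have "s \<in> Pi\<^sub>E Npos W"
      using sD by (auto simp: W_def PiE_iff)
    moreover have "Pi\<^sub>E Npos W \<subseteq> U"
    proof
      fix t assume t: "t \<in> Pi\<^sub>E Npos W"
      have "t i \<in> D" if "i \<in> Npos" for i
        using PiE_mem[OF t that] sD that by (auto simp: W_def split: if_splits)
      then have "t \<in> Npos \<rightarrow>\<^sub>E D" using t by (auto simp: PiE_iff)
      moreover have "\<forall>i\<in>{1..n}. t i = s i"
        using PiE_mem[OF t] by (force simp: W_def)
      ultimately show "t \<in> U" by (rule n)
    qed
    ultimately show "\<exists>W. finite {i \<in> Npos. W i \<noteq> topspace (discrete_topology D)} \<and>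
        (\<forall>i\<in>Npos. openin (discrete_topology D) (W i)) \<and> s \<in> Pi\<^sub>E Npos W \<and> Pi\<^sub>E Npos W \<subseteq> U"
      by blast
  qed
qed

lemma openin_contains_cylinder:
  assumes "openin (product_topology (\<lambda>_. discrete_topology D) Npos) U" "s \<in> U"
  obtains n where "\<And>t. t \<in> Npos \<rightarrow>\<^sub>E D \<Longrightarrow> \<forall>i\<in>{1..n}. t i = s i \<Longrightarrow> t \<in> U"
  using assms unfolding openin_sequence_space_iff by meson

lemma openin_cylinder:
  "openin (product_topology (\<lambda>_. discrete_topology D) Npos)
     {t \<in> Npos \<rightarrow>\<^sub>E D. \<forall>i\<in>{1..n}. t i = s i}"
  unfolding openin_sequence_space_iff by (auto intro!: exI[of _ n])

lemma topspace_baire_space: "topspace baire_space = Npos \<rightarrow>\<^sub>E Npos"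
  by (simp add: baire_space_def)

lemma topspace_cantor_space: "topspace cantor_space = Npos \<rightarrow>\<^sub>E {0, 1}"
  by (simp add: cantor_space_def)

lemma compact_space_cantor_space: "compact_space cantor_space"
  by (simp add: cantor_space_def compact_space_product_topology compact_space_discrete_topology)

lemma Hausdorff_space_cantor_space: "Hausdorff_space cantor_space"
  by (simp add: cantor_space_def Hausdorff_space_product_topology)

section \<open>Ideals with the Baire property are meager\<close>

text \<open>On the values 0 and 1 the truncated difference \<open>1 - y i\<close> is the
  complementary bit, so this is an involution of the Cantor space that maps every cylinder of length
  \<open>n\<close> to itself.\<close>

definition flip_after :: "nat \<Rightarrow> (nat \<Rightarrow> nat) \<Rightarrow> nat \<Rightarrow> nat" where
  "flip_after n y = (\<lambda>i\<in>Npos. if i \<le> n then y i else 1 - y i)"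

lemma flip_after_in_cantor_space:
  "y \<in> topspace cantor_space \<Longrightarrow> flip_after n y \<in> topspace cantor_space"
  by (auto simp: flip_after_def topspace_cantor_space PiE_iff)

lemma flip_after_flip_after:
  assumes "y \<in> topspace cantor_space"
  shows "flip_after n (flip_after n y) = y"
proof
  fix i
  show "flip_after n (flip_after n y) i = y i"
  proof (cases "i \<in> Npos")
    case True
    then have "y i \<in> {0, 1}" using assms by (auto simp: topspace_cantor_space)
    then show ?thesis using True by (auto simp: flip_after_def)
  next
    case False
    then show ?thesis using assms by (auto simp: flip_after_def topspace_cantor_space PiE_iff extensional_def)
  qed
qed

lemma continuous_map_flip_after: "continuous_map cantor_space cantor_space (flip_after n)"
proof -
  have "continuous_map cantor_space (discrete_topology {0, 1}) (\<lambda>y. flip_after n y i)"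
    if i: "i \<in> Npos" for i
  proof -
    have "continuous_map (discrete_topology {0, 1}) (discrete_topology {0, 1})
        (\<lambda>v::nat. if i \<le> n then v else 1 - v)"
      by simp
    from continuous_map_compose[OF continuous_map_product_projection[OF i] this]
    show ?thesis using i by (simp add: cantor_space_def o_def flip_after_def)
  qed
  then show ?thesis
    unfolding cantor_space_def continuous_map_componentwise
    by (auto simp: flip_after_def)
qed

lemma homeomorphic_maps_flip_after:
  "homeomorphic_maps cantor_space cantor_space (flip_after n) (flip_after n)"
  by (simp add: homeomorphic_maps_def continuous_map_flip_after flip_after_flip_after)

lemma openin_subset_interior_closure:
  assumes "openin Y V" "V \<noteq> {}" "V \<subseteq> Y closure_of S"
  shows "Y interior_of (Y closure_of S) \<noteq> {}"
  using assms interior_of_maximal by blast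

text \<open>A homeomorphism is open, so the image of a nonempty open set is itself the open set
  demanded by \<open>meager_in_preimage\<close>.\<close>

lemma meager_in_preimage_flip_after:
  assumes "meager_in cantor_space M"
  shows "meager_in cantor_space {y \<in> topspace cantor_space. flip_after n y \<in> M}"
proof (rule meager_in_preimage[OF continuous_map_flip_after _ assms])
  fix U assume U: "openin cantor_space U" "U \<noteq> {}"
  have "openin cantor_space (flip_after n ` U)"
    using homeomorphic_imp_open_map[OF homeomorphic_maps_imp_map[OF homeomorphic_maps_flip_after]] U(1)
    by (simp add: open_map_def)
  then show "cantor_space interior_of (cantor_space closure_of flip_after n ` U) \<noteq> {}"
    using U(2) by (intro openin_subset_interior_closure[of _ "flip_after n ` U"])
      (auto intro!: closure_of_subset openin_subset)
qed

lemma char_fun_apply: "i \<in> Npos \<Longrightarrow> char_fun A i = (if i \<in> A then 1 else 0)"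
  by (simp add: char_fun_def)

lemma admissible_idealD:
  assumes "admissible_ideal \<I>"
  shows "A \<in> \<I> \<Longrightarrow> A \<subseteq> Npos" "A \<in> \<I> \<Longrightarrow> B \<subseteq> A \<Longrightarrow> B \<in> \<I>"
    "A \<in> \<I> \<Longrightarrow> B \<in> \<I> \<Longrightarrow> A \<union> B \<in> \<I>" "Npos \<notin> \<I>"
    "A \<subseteq> Npos \<Longrightarrow> finite A \<Longrightarrow> A \<in> \<I>"
  using assms unfolding admissible_ideal_def by blast+

text \<open>Adding the finite complement, which belongs to the ideal by admissibility, would produce
  \<open>Npos\<close>.\<close>

lemma admissible_ideal_cofinite:
  assumes "admissible_ideal \<I>" "finite (Npos - A)"
  shows "A \<notin> \<I>"
proof
  assume A: "A \<in> \<I>"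
  have "Npos - A \<in> \<I>" by (rule admissible_idealD(5)[OF assms(1) Diff_subset assms(2)])
  then have "A \<union> (Npos - A) \<in> \<I>" by (rule admissible_idealD(3)[OF assms(1) A])
  moreover have "A \<union> (Npos - A) = Npos" using admissible_idealD(1)[OF assms(1) A] by blast
  ultimately show False using admissible_idealD(4)[OF assms(1)] by simp
qed

text \<open>The Baire property enters the later arguments only through this conclusion.\<close>

theorem ideal_with_baire_property_meager:
  assumes \<I>: "admissible_ideal \<I>" and bp: "ideal_has_baire_property \<I>"
  shows "meager_in cantor_space (char_fun ` \<I>)"
proof (rule ccontr)
  let ?C = cantor_space and ?J = "char_fun ` \<I>"
  assume nm: "\<not> meager_in ?C ?J"
  obtain U where U: "openin ?C U" "meager_in ?C (?J - U \<union> (U - ?J))"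
    using baire_property_in_imp_open_mod_meager bp unfolding ideal_has_baire_property_def by blast
  \<comment> \<open>For empty \<open>U\<close> the meager symmetric difference would be
    \<open>?J\<close> itself.\<close>
  have "U \<noteq> {}" using U(2) nm by auto
  then obtain s where s: "s \<in> U" by auto
  have sC: "s \<in> Npos \<rightarrow>\<^sub>E {0, 1}" using s openin_subset[OF U(1)] unfolding topspace_cantor_space by blast
  obtain n where n: "\<And>t. t \<in> Npos \<rightarrow>\<^sub>E {0, 1} \<Longrightarrow> \<forall>i\<in>{1..n}. t i = s i \<Longrightarrow> t \<in> U"
    using openin_contains_cylinder[OF U(1)[unfolded cantor_space_def] s] by blast
  define Z where "Z = {t \<in> Npos \<rightarrow>\<^sub>E {0, 1::nat}. \<forall>i\<in>{1..n}. t i = s i}"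
  define M where "M = U - ?J"
  have M: "meager_in ?C M"
    unfolding M_def by (rule meager_in_subset[OF U(2)]) blast
  have Z: "openin ?C Z" unfolding Z_def cantor_space_def by (rule openin_cylinder)
  have "s \<in> Z" using sC by (simp add: Z_def)
  then have "\<not> meager_in ?C Z"
    using compact_Hausdorff_open_not_meager_in[OF compact_space_cantor_space
        Hausdorff_space_cantor_space Z] by blast
  moreover have "meager_in ?C (M \<union> {y \<in> topspace ?C. flip_after n y \<in> M})"
    by (intro meager_in_Un M meager_in_preimage_flip_after)
  \<comment> \<open>The nonmeager cylinder \<open>Z\<close> cannot be covered by two meager sets,
    which yields a \<open>y\<close> such that both \<open>y\<close> and its flip avoid
    \<open>M\<close>.\<close>
  ultimately have "\<not> Z \<subseteq> M \<union> {y \<in> topspace ?C. flip_after n y \<in> M}"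
    using meager_in_subset by blast
  then obtain y where y: "y \<in> Z" "y \<notin> M" "y \<in> topspace ?C \<Longrightarrow> flip_after n y \<notin> M" by blast
  have yC: "y \<in> topspace ?C" using y(1) by (simp add: Z_def topspace_cantor_space)
  have "flip_after n y \<in> Z"
    using flip_after_in_cantor_space[OF yC, of n] y(1)
    by (auto simp: Z_def topspace_cantor_space flip_after_def)
  then have "flip_after n y \<in> U" "y \<in> U" using n y(1) by (auto simp: Z_def)
  then have "y \<in> ?J" "flip_after n y \<in> ?J" using y yC by (auto simp: M_def)
  then obtain A B where A: "A \<in> \<I>" "y = char_fun A" and B: "B \<in> \<I>" "flip_after n y = char_fun B"
    by blast
  \<comment> \<open>Beyond \<open>n\<close> the two codes carry complementary bits, so exactly one
    of \<open>A\<close> and \<open>B\<close> contains \<open>i\<close>.\<close>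
  have "i \<in> A \<union> B" if "i \<in> Npos" "\<not> i \<le> n" for i
    using fun_cong[OF B(2), of i] that unfolding A(2)
    by (auto simp: flip_after_def char_fun_apply split: if_splits)
  then have "Npos - (A \<union> B) \<subseteq> {..n}" by auto
  then have "finite (Npos - (A \<union> B))" by (rule finite_subset) simp
  then show False
    using admissible_ideal_cofinite[OF \<I>] admissible_idealD(3)[OF \<I> A(1) B(1)] by blast
qed

section \<open>Preimages of a fixed set under sequences\<close>

text \<open>Coding the preimage of \<open>B\<close> as a point of the Cantor space turns a condition
  on the ideal into a preimage under a continuous map.\<close>

definition preimage_code :: "nat set \<Rightarrow> (nat \<Rightarrow> nat) \<Rightarrow> nat \<Rightarrow> nat" where
  "preimage_code B s = char_fun {i \<in> Npos. s i \<in> B}"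

text \<open>This common property lets one density argument serve both sequence spaces. The window
  ends at \<open>m\<close> because a permutation cannot send all indices beyond \<open>n\<close>
  into a co-infinite \<open>B\<close>; a finite window suffices for the product topology.\<close>

definition realises_patterns :: "(nat \<Rightarrow> nat) set \<Rightarrow> bool" where
  "realises_patterns Z \<longleftrightarrow>
     (\<forall>B s n m Q. infinite B \<longrightarrow> infinite (Npos - B) \<longrightarrow> B \<subseteq> Npos \<longrightarrow> s \<in> Z \<longrightarrow>
        (\<exists>t\<in>Z. (\<forall>i\<in>{1..n}. t i = s i) \<and> (\<forall>i\<in>{n<..m}. t i \<in> B \<longleftrightarrow> i \<in> Q)))"

lemma preimage_code_in_sequence_space: "preimage_code B s \<in> Npos \<rightarrow>\<^sub>E {0, 1}"
  by (auto simp: preimage_code_def char_fun_def indicator_def)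

lemma continuous_map_preimage_code:
  "continuous_map baire_space cantor_space (preimage_code B)"
proof -
  have "continuous_map baire_space (discrete_topology {0, 1}) (\<lambda>s. preimage_code B s i)"
    if i: "i \<in> Npos" for i
  proof -
    have "continuous_map (discrete_topology Npos) (discrete_topology {0, 1::nat})
        (\<lambda>v. if v \<in> B then 1 else 0)"
      by simp
    from continuous_map_compose[OF continuous_map_product_projection[OF i] this]
    show ?thesis using i by (simp add: baire_space_def o_def preimage_code_def char_fun_apply)
  qed
  then show ?thesis
    unfolding cantor_space_def continuous_map_componentwise
    by (auto simp: preimage_code_def char_fun_def)
qed

text \<open>Verifies the condition of \<open>meager_in_preimage\<close>: once the first
  \<open>n\<close> values of a sequence are fixed, the codes of its extensions in \<open>Z\<close>
  are dense in the cylinder given by the first \<open>n\<close> bits.\<close>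

lemma meager_in_preimage_code:
  assumes Z: "Z \<subseteq> topspace baire_space" "realises_patterns Z"
    and B: "B \<subseteq> Npos" "infinite B" "infinite (Npos - B)"
    and M: "meager_in cantor_space M"
  shows "meager_in (subtopology baire_space Z) {s \<in> Z. preimage_code B s \<in> M}"
proof -
  let ?f = "preimage_code B"
  have ts: "topspace (subtopology baire_space Z) = Z" using Z(1) by auto
  have cont: "continuous_map (subtopology baire_space Z) cantor_space ?f"
    by (intro continuous_map_from_subtopology continuous_map_preimage_code)
  have big: "cantor_space interior_of (cantor_space closure_of ?f ` U) \<noteq> {}"
    if U: "openin (subtopology baire_space Z) U" "U \<noteq> {}" for U
  proof -
    obtain O' where O': "openin baire_space O'" "U = O' \<inter> Z"
      using U(1) by (auto simp: openin_subtopology)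
    obtain s where s: "s \<in> O'" "s \<in> Z" using U(2) O'(2) by auto
    obtain n where n: "\<And>t. t \<in> Npos \<rightarrow>\<^sub>E Npos \<Longrightarrow> \<forall>i\<in>{1..n}. t i = s i \<Longrightarrow> t \<in> O'"
      using openin_contains_cylinder[OF O'(1)[unfolded baire_space_def] s(1)] by blast
    define V where "V = {y \<in> Npos \<rightarrow>\<^sub>E {0, 1::nat}. \<forall>i\<in>{1..n}. y i = ?f s i}"
    have "?f s \<in> V" using preimage_code_in_sequence_space by (simp add: V_def)
    moreover have "openin cantor_space V"
      unfolding V_def cantor_space_def by (rule openin_cylinder)
    moreover have "V \<subseteq> cantor_space closure_of ?f ` U"
    proof
      fix y assume y: "y \<in> V"
      have "\<exists>z. z \<in> ?f ` U \<and> z \<in> W" if W: "y \<in> W" "openin cantor_space W" for W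
      proof -
        obtain m where m: "\<And>t. t \<in> Npos \<rightarrow>\<^sub>E {0, 1} \<Longrightarrow> \<forall>i\<in>{1..m}. t i = y i \<Longrightarrow> t \<in> W"
          using openin_contains_cylinder[OF W(2)[unfolded cantor_space_def] W(1)] by blast
        \<comment> \<open>The shared prefix keeps \<open>t\<close> in \<open>U\<close> and, as
          \<open>y\<close> lies in \<open>V\<close>, already gives the right bits up to
          \<open>n\<close>; the pattern supplies the bits of \<open>y\<close> from there up to
          \<open>m\<close>.\<close>
        obtain t where t: "t \<in> Z" "\<forall>i\<in>{1..n}. t i = s i"
          "\<forall>i\<in>{n<..m}. t i \<in> B \<longleftrightarrow> i \<in> {i. y i = 1}"
          using Z(2) B s(2) unfolding realises_patterns_def by blast
        have "t \<in> U" using n[of t] t Z(1) O'(2) by (auto simp: topspace_baire_space)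
        moreover have "?f t \<in> W"
        proof (rule m)
          show "?f t \<in> Npos \<rightarrow>\<^sub>E {0, 1}" by (rule preimage_code_in_sequence_space)
          show "\<forall>i\<in>{1..m}. ?f t i = y i"
          proof
            fix i assume i: "i \<in> {1..m}"
            show "?f t i = y i"
            proof (cases "i \<le> n")
              case True
              then have "y i = ?f s i" using y i by (auto simp: V_def)
              then show ?thesis using True t(2) i by (auto simp: preimage_code_def char_fun_apply)
            next
              case False
              have "i \<in> Npos" using i by simp
              then have "y i \<in> {0, 1}" using y unfolding V_def by blast
              then show ?thesis using False t(3) i by (auto simp: preimage_code_def char_fun_apply)
            qed
          qed
        qed
        ultimately show ?thesis by blast
      qed
      then show "y \<in> cantor_space closure_of ?f ` U"
        using y by (auto simp: in_closure_of V_def topspace_cantor_space)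
    qed
    ultimately show ?thesis by (intro openin_subset_interior_closure[of _ V]) auto
  qed
  have "meager_in (subtopology baire_space Z)
      {s \<in> topspace (subtopology baire_space Z). ?f s \<in> M}"
    by (rule meager_in_preimage[OF cont _ M]) (rule big)
  then show ?thesis by (simp only: ts)
qed

text \<open>Both \<open>B\<close> and its complement are unbounded, so each next value can be chosen
  above the previous one on the prescribed side. The bound \<open>v\<close> will separate these
  values from a given prefix.\<close>

lemma strict_mono_pattern:
  fixes B Q :: "nat set"
  assumes "infinite B" "infinite (Npos - B)"
  shows "\<exists>g. strict_mono g \<and> (\<forall>i. v < g i \<and> (g i \<in> B \<longleftrightarrow> i \<in> Q))"
proof -
  have ex: "\<exists>k>w. k \<in> B \<longleftrightarrow> b" for w b
    using assms unfolding infinite_nat_iff_unbounded by (cases b) blast+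
  have "\<exists>g. \<forall>i. (v < g i \<and> (g i \<in> B \<longleftrightarrow> i \<in> Q)) \<and> g i < g (Suc i)"
  proof (rule dependent_nat_choice)
    show "\<exists>k. v < k \<and> (k \<in> B \<longleftrightarrow> 0 \<in> Q)" using ex by blast
    fix w i assume "v < w \<and> (w \<in> B \<longleftrightarrow> i \<in> Q)"
    then show "\<exists>k. (v < k \<and> (k \<in> B \<longleftrightarrow> Suc i \<in> Q)) \<and> w < k"
      using ex[of w "Suc i \<in> Q"] by (meson less_trans)
  qed
  then show ?thesis by (auto simp: strict_mono_Suc_iff)
qed

lemma finite_prefix_bounded: "\<exists>v. \<forall>i\<le>n. (s :: nat \<Rightarrow> nat) i \<le> v"
  by (rule exI[of _ "Max (s ` {..n})"]) simp

text \<open>The prefix of \<open>s\<close> is continued by a pattern sequence whose values all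
  exceed those of the prefix.\<close>

lemma realises_patterns_incr_seqs: "realises_patterns incr_seqs"
  unfolding realises_patterns_def
proof (intro allI impI)
  fix B Q :: "nat set" and s :: "nat \<Rightarrow> nat" and n m :: nat
  assume B: "infinite B" "infinite (Npos - B)" and s: "s \<in> incr_seqs"
  obtain v where v: "\<forall>i\<le>n. s i \<le> v" using finite_prefix_bounded by blast
  obtain g where g: "strict_mono g" "\<And>i. v < g i \<and> (g i \<in> B \<longleftrightarrow> i \<in> Q)"
    using strict_mono_pattern[OF B] by blast
  define t where "t = (\<lambda>i\<in>Npos. if i \<le> n then s i else g i)"
  have "s i \<in> Npos" if "i \<in> Npos" for i
    using s that by (auto simp: incr_seqs_def topspace_baire_space)
  moreover have "g i \<in> Npos" for i using g(2)[of i] by simp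
  ultimately have "t \<in> topspace baire_space"
    unfolding t_def topspace_baire_space by (intro restrict_PiE_iff[THEN iffD2]) simp
  moreover have "t i < t (i + 1)" if "i \<in> Npos" for i
  proof -
    \<comment> \<open>Inside the prefix, at the junction where \<open>v\<close> lies between the two
      values, and in the tail.\<close>
    consider "i + 1 \<le> n" | "i = n" | "n < i" by linarith
    then show ?thesis
    proof cases
      case 1 then show ?thesis using s that by (auto simp: t_def incr_seqs_def)
    next
      case 2
      then show ?thesis using v g(2)[of "i + 1"] that by (auto simp: t_def intro: le_less_trans)
    next
      case 3 then show ?thesis using g(1) that by (auto simp: t_def strict_mono_def)
    qed
  qed
  ultimately have "t \<in> incr_seqs" by (simp add: incr_seqs_def)
  moreover have "\<forall>i\<in>{1..n}. t i = s i" by (simp add: t_def)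
  moreover have "\<forall>i\<in>{n<..m}. t i \<in> B \<longleftrightarrow> i \<in> Q" using g(2) by (auto simp: t_def)
  ultimately show "\<exists>t\<in>incr_seqs. (\<forall>i\<in>{1..n}. t i = s i) \<and> (\<forall>i\<in>{n<..m}. t i \<in> B \<longleftrightarrow> i \<in> Q)"
    by blast
qed

text \<open>The complements of \<open>A\<close> and of its image are both countably infinite, so
  matching their enumerations completes \<open>q\<close>.\<close>

lemma extend_injection_to_bijection:
  assumes "finite A" "A \<subseteq> Npos" "inj_on q A" "q ` A \<subseteq> Npos"
  shows "\<exists>p\<in>permutations_Npos. \<forall>i\<in>A. p i = q i"
proof -
  have inf: "infinite Npos" by (rule infinite_Ici)
  obtain h where h: "bij_betw h (Npos - A) (Npos - q ` A)"
    using bij_betw_trans[OF bij_betw_inv_into[OF bij_betw_from_nat_into[of "Npos - A"]]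
        bij_betw_from_nat_into[of "Npos - q ` A"]] assms(1) inf by auto
  define p where "p = (\<lambda>i\<in>Npos. if i \<in> A then q i else h i)"
  have "bij_betw p A (q ` A)"
    using assms(2,3) by (subst bij_betw_cong[of _ _ q]) (auto simp: p_def inj_on_imp_bij_betw)
  moreover have "bij_betw p (Npos - A) (Npos - q ` A)"
    using h by (subst bij_betw_cong[of _ _ h]) (auto simp: p_def)
  ultimately have "bij_betw p (A \<union> (Npos - A)) (q ` A \<union> (Npos - q ` A))"
    by (rule bij_betw_combine) blast
  then have bij: "bij_betw p Npos Npos" using assms(2,4) by (simp add: Un_absorb1)
  moreover have "p \<in> topspace baire_space"
    using bij_betw_apply[OF bij] by (auto simp: topspace_baire_space PiE_iff p_def)
  ultimately have "p \<in> permutations_Npos" by (simp add: permutations_Npos_def)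
  then show ?thesis using assms(2) by (intro bexI[of _ p]) (auto simp: p_def)
qed

text \<open>Prefix followed by pattern is injective but may miss values; only its finite part is
  kept and then completed to a bijection.\<close>

lemma realises_patterns_permutations: "realises_patterns permutations_Npos"
  unfolding realises_patterns_def
proof (intro allI impI)
  fix B Q :: "nat set" and s :: "nat \<Rightarrow> nat" and n m :: nat
  assume B: "infinite B" "infinite (Npos - B)" and s: "s \<in> permutations_Npos"
  obtain v where v: "\<forall>i\<le>n. s i \<le> v" using finite_prefix_bounded by blast
  obtain g where g: "strict_mono g" "\<And>i. v < g i \<and> (g i \<in> B \<longleftrightarrow> i \<in> Q)"
    using strict_mono_pattern[OF B] by blast
  define q where "q = (\<lambda>i. if i \<le> n then s i else g i)"
  \<comment> \<open>The maximum keeps the whole prefix even when \<open>m < n\<close>.\<close>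
  let ?A = "{1..max n m}"
  have "inj_on s Npos" using s by (simp add: permutations_Npos_def bij_betw_def)
  \<comment> \<open>Both \<open>s\<close> and \<open>g\<close> are injective, and \<open>v\<close>
    separates the prefix values of \<open>s\<close> from the values of \<open>g\<close>.\<close>
  then have "inj_on q ?A"
    using v g(2) strict_mono_eq[OF g(1)]
    by (auto simp: inj_on_def q_def dest: leD) (metis leD)+
  moreover have "q ` ?A \<subseteq> Npos"
  proof (rule image_subsetI)
    fix i assume "i \<in> ?A"
    then have "s i \<in> Npos" using s by (auto simp: permutations_Npos_def topspace_baire_space)
    then show "q i \<in> Npos" using g(2)[of i] by (auto simp: q_def)
  qed
  ultimately obtain p where p: "p \<in> permutations_Npos" "\<forall>i\<in>?A. p i = q i"
    using extend_injection_to_bijection[of ?A q] by auto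
  have "\<forall>i\<in>{1..n}. p i = s i" using p(2) by (auto simp: q_def)
  moreover have "\<forall>i\<in>{n<..m}. p i \<in> B \<longleftrightarrow> i \<in> Q" using p(2) g(2) by (auto simp: q_def)
  ultimately show "\<exists>t\<in>permutations_Npos.
      (\<forall>i\<in>{1..n}. t i = s i) \<and> (\<forall>i\<in>{n<..m}. t i \<in> B \<longleftrightarrow> i \<in> Q)"
    using p(1) by blast
qed

section \<open>Ideal convergence along subsequences and rearrangements\<close>

lemma divergent_in_infinitely_far:
  assumes "Metric_space X d" "\<forall>n\<in>Npos. x n \<in> X" "divergent_in X d x" "l \<in> X"
  shows "\<exists>\<epsilon>>0. infinite {m \<in> Npos. d (x m) l \<ge> \<epsilon>}"
proof (rule ccontr)
  interpret Metric_space X d by fact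
  assume H: "\<not> ?thesis"
  have "limitin mtopology x l sequentially"
    unfolding limitin_metric
  proof (intro conjI allI impI)
    show "l \<in> X" by fact
    fix \<epsilon> :: real assume "\<epsilon> > 0"
    then have "finite {m \<in> Npos. d (x m) l \<ge> \<epsilon>}" using H by blast
    then obtain N where N: "\<And>m. m \<in> Npos \<Longrightarrow> d (x m) l \<ge> \<epsilon> \<Longrightarrow> m \<le> N"
      unfolding finite_nat_set_iff_bounded_le by auto
    show "\<forall>\<^sub>F m in sequentially. x m \<in> X \<and> d (x m) l < \<epsilon>"
    \<comment> \<open>Starting at \<open>N + 1\<close> also excludes the index 0, where
      \<open>x\<close> may leave \<open>X\<close>.\<close>
    proof (rule eventually_sequentiallyI[of "N + 1"])
      fix m assume "N + 1 \<le> m"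
      then have "m \<in> Npos" "\<not> m \<le> N" by auto
      then show "x m \<in> X \<and> d (x m) l < \<epsilon>" using assms(2) N[of m] by fastforce
    qed
  qed
  then show False using assms(3) unfolding divergent_in_def by blast
qed

text \<open>Trades the unknown limit and radius, possibly uncountably many, for the natural numbers
  \<open>j\<close> and \<open>k\<close>.\<close>

lemma ideal_convergent_imp_preimage_code:
  assumes \<I>: "admissible_ideal \<I>" and X: "Metric_space X d" "\<forall>n\<in>Npos. x n \<in> X"
    and div: "divergent_in X d x"
    and s: "s \<in> topspace baire_space" "inj_on s Npos"
    and conv: "ideal_convergent \<I> X d (\<lambda>n. x (s n))"
  shows "\<exists>j k. let B = {m \<in> Npos. d (x m) (x j) \<ge> 1 / Suc k} in
           infinite B \<and> infinite (Npos - B) \<and> preimage_code B s \<in> char_fun ` \<I>"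
proof -
  interpret Metric_space X d by fact
  obtain l where l: "l \<in> X" and small: "\<And>\<epsilon>. \<epsilon> > 0 \<Longrightarrow> {n \<in> Npos. d (x (s n)) l \<ge> \<epsilon>} \<in> \<I>"
    using conv unfolding ideal_convergent_def ideal_converges_to_def by blast
  have sN: "s n \<in> Npos" if "n \<in> Npos" for n
    using s(1) that by (auto simp: topspace_baire_space)
  obtain \<epsilon> where \<epsilon>: "\<epsilon> > 0" "infinite {m \<in> Npos. d (x m) l \<ge> \<epsilon>}"
    using divergent_in_infinitely_far[OF X div l] by blast
  obtain k where "1 / Suc k < \<epsilon> / 2" using \<epsilon>(1) nat_approx_posE[of "\<epsilon> / 2"] by auto
  then obtain q where q: "q = 1 / Suc k" "0 < q" "q < \<epsilon> / 2" by simp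
  \<comment> \<open>Since \<open>Npos\<close> is not in the ideal, some term of the sequence is
    close to \<open>l\<close>; it becomes the centre \<open>x j\<close>.\<close>
  have "{n \<in> Npos. d (x (s n)) l \<ge> q / 2} \<noteq> Npos"
    using small[of "q / 2"] q(2) admissible_idealD(4)[OF \<I>] by auto
  then obtain n0 where n0: "n0 \<in> Npos" "d (x (s n0)) l < q / 2" by force
  define j where "j = s n0"
  have j: "x j \<in> X" "d (x j) l < q / 2" using n0 sN X(2) by (auto simp: j_def)
  define B where "B = {m \<in> Npos. d (x m) (x j) \<ge> q}"
  \<comment> \<open>Moving the centre from \<open>l\<close> to \<open>x j\<close> costs less than
    \<open>q / 2\<close>, and \<open>\<epsilon> - q / 2 > q\<close>.\<close>
  have "{m \<in> Npos. d (x m) l \<ge> \<epsilon>} \<subseteq> B"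
  proof
    fix m assume "m \<in> {m \<in> Npos. d (x m) l \<ge> \<epsilon>}"
    then have m: "m \<in> Npos" "d (x m) l \<ge> \<epsilon>" by auto
    have "d (x m) l \<le> d (x m) (x j) + d (x j) l" using triangle m(1) j(1) l X(2) by blast
    then show "m \<in> B" using m j(2) q(2,3) by (simp add: B_def)
  qed
  then have inf: "infinite B" using \<epsilon>(2) finite_subset by blast
  \<comment> \<open>Moving the centre back to \<open>l\<close> leaves a distance of at least
    \<open>q / 2\<close>, and the set of such \<open>n\<close> is in the ideal.\<close>
  have "{n \<in> Npos. s n \<in> B} \<subseteq> {n \<in> Npos. d (x (s n)) l \<ge> q / 2}"
  proof
    fix n assume "n \<in> {n \<in> Npos. s n \<in> B}"
    then have n: "n \<in> Npos" "s n \<in> B" by auto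
    have "d (x (s n)) (x j) \<le> d (x (s n)) l + d l (x j)"
      using triangle n(1) sN j(1) l X(2) by blast
    then show "n \<in> {n \<in> Npos. d (x (s n)) l \<ge> q / 2}"
      using n j(2) commute[of l "x j"] by (simp add: B_def)
  qed
  then have pre: "{n \<in> Npos. s n \<in> B} \<in> \<I>"
    using admissible_idealD(2)[OF \<I> small[of "q / 2"]] q(2) by simp
  \<comment> \<open>Otherwise injectivity of \<open>s\<close> would make the preimage of
    \<open>B\<close> cofinite, although it lies in the ideal.\<close>
  have "infinite (Npos - B)"
  proof
    assume "finite (Npos - B)"
    then have "finite (s -` (Npos - B) \<inter> Npos)" using s(2) by (rule finite_vimage_IntI)
    moreover have "Npos - {n \<in> Npos. s n \<in> B} \<subseteq> s -` (Npos - B) \<inter> Npos" using sN by auto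
    ultimately show False using admissible_ideal_cofinite[OF \<I>] pre finite_subset by blast
  qed
  then show ?thesis
    using inf pre unfolding B_def q(1) preimage_code_def Let_def by blast
qed

lemma meager_in_ideal_convergent:
  assumes \<I>: "admissible_ideal \<I>" "ideal_has_baire_property \<I>"
    and X: "Metric_space X d" "\<forall>n\<in>Npos. x n \<in> X" and div: "divergent_in X d x"
    and Z: "Z \<subseteq> topspace baire_space" "realises_patterns Z" "\<And>s. s \<in> Z \<Longrightarrow> inj_on s Npos"
  shows "meager_in (subtopology baire_space Z) {s \<in> Z. ideal_convergent \<I> X d (\<lambda>n. x (s n))}"
proof -
  define B where "B = (\<lambda>(j, k). {m \<in> Npos. d (x m) (x j) \<ge> 1 / Suc k})"
  \<comment> \<open>The pairs to which the pullback lemma applies; there are countably many, so the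
    union over them stays meager.\<close>
  define K where "K = {jk. infinite (B jk) \<and> infinite (Npos - B jk)}"
  have "meager_in (subtopology baire_space Z)
      (\<Union>jk\<in>K. {s \<in> Z. preimage_code (B jk) s \<in> char_fun ` \<I>})"
    by (intro meager_in_UN meager_in_preimage_code Z ideal_with_baire_property_meager \<I>)
      (auto simp: K_def B_def)
  moreover have "{s \<in> Z. ideal_convergent \<I> X d (\<lambda>n. x (s n))}
      \<subseteq> (\<Union>jk\<in>K. {s \<in> Z. preimage_code (B jk) s \<in> char_fun ` \<I>})"
  proof clarify
    fix s assume s: "s \<in> Z" "ideal_convergent \<I> X d (\<lambda>n. x (s n))"
    then have "\<exists>j k. infinite (B (j, k)) \<and> infinite (Npos - B (j, k)) \<and>
        preimage_code (B (j, k)) s \<in> char_fun ` \<I>"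
      using ideal_convergent_imp_preimage_code[OF \<I>(1) X div _ Z(3) s(2)] Z(1)
      unfolding B_def Let_def by auto
    then show "s \<in> (\<Union>jk\<in>K. {s \<in> Z. preimage_code (B jk) s \<in> char_fun ` \<I>})"
      using s(1) unfolding K_def by blast
  qed
  ultimately show ?thesis by (rule meager_in_subset)
qed

text \<open>Shifting the index by one gives a strictly monotone function on all of
  \<open>nat\<close>.\<close>

lemma inj_on_incr_seqs:
  assumes "s \<in> incr_seqs"
  shows "inj_on s Npos"
proof -
  have "s (Suc i) < s (Suc (Suc i))" for i using assms by (auto simp: incr_seqs_def)
  then have "strict_mono (\<lambda>i. s (Suc i))" by (simp add: strict_mono_Suc_iff)
  then have "inj (\<lambda>i. s (Suc i))" by (rule strict_mono_imp_inj_on)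
  then show ?thesis
    unfolding inj_on_def by (metis UNIV_I atLeast_iff Suc_le_D One_nat_def)
qed

theorem theorem1p2:
  fixes \<I> :: "nat set set"
    and X :: "'a set"
    and d :: "'a \<Rightarrow> 'a \<Rightarrow> real"
    and x :: "nat \<Rightarrow> 'a"
  assumes "admissible_ideal \<I>"
    and "ideal_has_baire_property \<I>"
    and "Metric_space X d"
    and "\<forall>n\<in>Npos. x n \<in> X"
    and "divergent_in X d x"
  shows "meager_in (subtopology baire_space incr_seqs) (E_set \<I> X d x) \<and>
         meager_in (subtopology baire_space permutations_Npos) (R_set \<I> X d x)"
  unfolding E_set_def R_set_def
proof
  show "meager_in (subtopology baire_space incr_seqs)
      {s \<in> incr_seqs. ideal_convergent \<I> X d (\<lambda>n. x (s n))}"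
    by (rule meager_in_ideal_convergent[OF assms _ realises_patterns_incr_seqs inj_on_incr_seqs])
      (auto simp: incr_seqs_def)
  show "meager_in (subtopology baire_space permutations_Npos)
      {p \<in> permutations_Npos. ideal_convergent \<I> X d (\<lambda>n. x (p n))}"
    by (rule meager_in_ideal_convergent[OF assms _ realises_patterns_permutations])
      (auto simp: permutations_Npos_def bij_betw_def)
qed

end
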